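(* Let $\mu\in\mathbb{R}$ and $\sigma>0$, and let $\nu$ be the lognormal distribution $\mathcal{LN}(\mu,\sigma^2)$. The polynomials orthonormal with respect to $\nu$ are given, for $k\in\mathbb{N}_0=\{0,1,2,\dots\}$, by $$Q_{k}(x)=\frac{e^{-\frac{k^{2}\sigma^{2}}{2}}}{\sqrt{\left[e^{-\sigma^{2}},e^{-\sigma^{2}}\right]_{k}}}\sum_{i=0}^{k}(-1)^{k+i}e^{-i\mu-\frac{i^{2}\sigma^{2}}{2}}\,e_{k-i}\left(1,e^{\sigma^2},\ldots,e^{(k-1)\sigma^{2}}\right)x^{i}.$$ That is, each $Q_k$ is a polynomial of degree $k$ and $\int Q_i Q_j\,d\nu=\delta_{ij}$ for all $i,j\in\mathbb{N}_0$.
   Context: The lognormal distribution $\mathcal{LN}(\mu,\sigma^2)$ is the distribution of $e^Y$ where $Y$ is normal with mean $\mu$ and variance $\sigma^2$. The elementary symmetric polynomials are $$e_{i}(X_{1},\ldots,X_{k})=\sum_{1\le j_1<\cdots<j_i\le k}X_{j_1}\cdots X_{j_i}\quad\text{for } i\le k,\qquad e_i(X_1,\ldots,X_k)=0\quad\text{for } i>k,$$ with $e_0=1$. The (non-bold) $e$ without subscript is the base of the natural exponential; the list $1,e^{\sigma^2},\dots,e^{(k-1)\sigma^2}$ has $k$ entries $e^{j\sigma^2}$, $j=0,\dots,k-1$ (empty if $k=0$). The Q-Pochhammer symbol is $[x,q]_{n}=\prod_{i=0}^{n-1}(1-xq^{i})$, with the empty product equal to $1$. $\delta_{ij}$ is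 the Kronecker symbol. *)

theory Defs
  imports "HOL-Probability.Probability" "HOL-Computational_Algebra.Polynomial"
begin

text \<open>As for \<^const>\<open>normal_density\<close>, the second parameter is the standard deviation
  \<open>\<sigma>\<close> of the underlying normal distribution, not its variance: this is the distribution of
  \<open>exp Y\<close> for \<open>Y\<close> normal with mean \<open>\<mu>\<close> and variance \<open>\<sigma>\<^sup>2\<close>.\<close>

definition lognormal :: "real \<Rightarrow> real \<Rightarrow> real measure" where
  "lognormal \<mu> \<sigma> = distr (density lborel (normal_density \<mu> \<sigma>)) borel exp"

text \<open>The increasing tuples of \<open>i\<close> indices are encoded as \<open>i\<close>-element sets of list positions, so
  repeated entries of the list count separately. The sum is empty if \<open>i > length xs\<close>.\<close>

definition esym :: "nat \<Rightarrow> 'a::comm_ring_1 list \<Rightarrow> 'a" where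
  "esym i xs = (\<Sum>J | J \<subseteq> {..<length xs} \<and> card J = i. \<Prod>j\<in>J. xs ! j)"

definition qpoch :: "'a::comm_ring_1 \<Rightarrow> 'a \<Rightarrow> nat \<Rightarrow> 'a" where
  "qpoch x q n = (\<Prod>i<n. 1 - x * q ^ i)"

definition Q :: "real \<Rightarrow> real \<Rightarrow> nat \<Rightarrow> real poly" where
  "Q \<mu> \<sigma> k =
     smult (exp (- ((real k)\<^sup>2 * \<sigma>\<^sup>2 / 2)) / sqrt (qpoch (exp (- \<sigma>\<^sup>2)) (exp (- \<sigma>\<^sup>2)) k))
       (\<Sum>i\<le>k. monom ((- 1) ^ (k + i) * exp (- (real i * \<mu>) - (real i)\<^sup>2 * \<sigma>\<^sup>2 / 2)
                    * esym (k - i) (map (\<lambda>j. exp (real j * \<sigma>\<^sup>2)) [0..<k])) i)"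

end

theory Submission
  imports Defs
begin

text \<open>With \<open>p = exp (\<sigma>\<^sup>2)\<close> the moments are \<open>exp (n\<mu> + n\<^sup>2\<sigma>\<^sup>2/2)\<close>, and
  \<open>(m + i)\<^sup>2 = m\<^sup>2 + i\<^sup>2 + 2mi\<close>. Hence the normalising factors in the coefficients of \<open>Q\<^sub>k\<close> cancel
  in the integral of \<open>x\<^sup>m Q\<^sub>k\<close>, and by Vieta's formula what is left is a multiple of
  \<open>\<Prod>j<k. p\<^sup>m - p\<^sup>j\<close>. This product vanishes for \<open>m < k\<close>, and for \<open>m = k\<close> it is \<open>p\<close> to the power
  \<open>k\<^sup>2\<close> times the Pochhammer symbol.\<close>

text \<open>Completing the square in the exponent absorbs the linear term \<open>t * y\<close> into
  a shift of the mean. Integrals of exponentials thereby reduce to the total mass of a normal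
  density.\<close>

lemma normal_density_times_exp:
  assumes "\<sigma> \<noteq> 0"
  shows "normal_density \<mu> \<sigma> y * exp (t * y) =
    exp (t * \<mu> + t\<^sup>2 * \<sigma>\<^sup>2 / 2) * normal_density (\<mu> + t * \<sigma>\<^sup>2) \<sigma> y"
proof -
  have "- (y - \<mu>)\<^sup>2 / (2 * \<sigma>\<^sup>2) + t * y =
      t * \<mu> + t\<^sup>2 * \<sigma>\<^sup>2 / 2 + - (y - (\<mu> + t * \<sigma>\<^sup>2))\<^sup>2 / (2 * \<sigma>\<^sup>2)"
    using assms by (simp add: field_simps power2_eq_square)
  then show ?thesis
    unfolding normal_density_def by (simp add: exp_add [symmetric])
qed

text \<open>Pulled back along \<open>exp\<close>, the power \<open>x ^ n\<close> becomes
  \<open>exp (n * y)\<close>; tilting by it leaves the constant \<open>?c\<close> times a normal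
  density of mass 1.\<close>

lemma has_bochner_integral_lognormal_power:
  assumes "\<sigma> > 0"
  shows "has_bochner_integral (lognormal \<mu> \<sigma>) (\<lambda>x. x ^ n)
    (exp (real n * \<mu> + (real n)\<^sup>2 * \<sigma>\<^sup>2 / 2))"
proof -
  let ?c = "exp (real n * \<mu> + (real n)\<^sup>2 * \<sigma>\<^sup>2 / 2)"
  have "has_bochner_integral lborel
      (\<lambda>y. ?c * normal_density (\<mu> + real n * \<sigma>\<^sup>2) \<sigma> y) (?c * 1)"
    using assms by (intro has_bochner_integral_mult_right)
      (auto simp: has_bochner_integral_iff)
  then have "has_bochner_integral lborel (\<lambda>y. normal_density \<mu> \<sigma> y *\<^sub>R exp y ^ n) ?c"
    using assms by (simp add: normal_density_times_exp [symmetric] exp_of_nat_mult)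
  then have "has_bochner_integral (density lborel (normal_density \<mu> \<sigma>)) (\<lambda>y. exp y ^ n) ?c"
    by (intro has_bochner_integral_density) auto
  then show ?thesis
    unfolding lognormal_def by (intro has_bochner_integral_distr) auto
qed

text \<open>Vieta's formula: expand the product over the sets \<open>J\<close> of positions that
  contribute \<open>- (xs ! j)\<close> instead of \<open>y\<close>. Using positions rather than
  values allows repeated entries and matches \<open>esym\<close>.\<close>

lemma prod_diff_eq_sum_esym:
  fixes y :: "'a::comm_ring_1"
  shows "(\<Prod>x\<leftarrow>xs. y - x) =
    (\<Sum>i\<le>length xs. (- 1) ^ (length xs + i) * esym (length xs - i) xs * y ^ i)"
proof -
  let ?n = "length xs"
  let ?f = "\<lambda>J. (\<Prod>j\<in>J. - (xs ! j)) * (\<Prod>j\<in>{..<?n} - J. y)"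
  have "(\<Prod>x\<leftarrow>xs. y - x) = (\<Prod>j<?n. - (xs ! j) + y)"
    by (simp add: prod.list_conv_set_nth atLeast0LessThan)
  also have "\<dots> = (\<Sum>J\<in>Pow {..<?n}. ?f J)"
    by (rule prod_add) simp
  \<comment> \<open>The groups are indexed by \<open>?n - card J\<close>, the exponent of
    \<open>y\<close>, not by \<open>card J\<close>.\<close>
  also have "\<dots> = (\<Sum>i\<le>?n. \<Sum>J\<in>{J \<in> Pow {..<?n}. ?n - card J = i}. ?f J)"
    by (rule sum.group [symmetric]) auto
  also have "\<dots> = (\<Sum>i\<le>?n. (- 1) ^ (?n + i) * esym (?n - i) xs * y ^ i)"
  proof (rule sum.cong [OF refl])
    fix i assume i: "i \<in> {..?n}"
    have card: "card J \<le> ?n" if "J \<subseteq> {..<?n}" for J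
      using card_mono [OF _ that] by simp
    have "{J \<in> Pow {..<?n}. ?n - card J = i} = {J. J \<subseteq> {..<?n} \<and> card J = ?n - i}"
      using i card by fastforce
    moreover have "?f J = (- 1) ^ (?n + i) * y ^ i * (\<Prod>j\<in>J. xs ! j)"
      if J: "J \<subseteq> {..<?n}" "card J = ?n - i" for J
    proof -
      have "card ({..<?n} - J) = i"
        using J i by (subst card_Diff_subset) (auto intro: finite_subset)
      \<comment> \<open>The two exponents differ by \<open>2 * i\<close>.\<close>
      moreover have "(- 1 :: 'a) ^ (?n - i) = (- 1) ^ (?n + i)"
        using i by (simp add: minus_one_power_iff)
      ultimately show ?thesis
        using J by (simp add: prod_uminus)
    qed
    ultimately show "(\<Sum>J\<in>{J \<in> Pow {..<?n}. ?n - card J = i}. ?f J) =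
        (- 1) ^ (?n + i) * esym (?n - i) xs * y ^ i"
      by (simp add: esym_def sum_distrib_left mult_ac)
  qed
  finally show ?thesis .
qed

lemma esym_0 [simp]: "esym 0 xs = 1"
proof -
  have "{J. J \<subseteq> {..<length xs} \<and> card J = 0} = {{}}"
    by (auto dest: finite_subset)
  then show ?thesis by (simp add: esym_def)
qed

lemma qpoch_pos:
  fixes q :: real
  assumes "0 \<le> q" "q < 1"
  shows "qpoch q q k > 0"
  unfolding qpoch_def
proof (rule prod_pos)
  fix i
  show "0 < 1 - q * q ^ i"
    using assms power_Suc_less_one [of q i] power_less_one_iff [of q "Suc i"] by simp
qed

text \<open>Reverse the product via \<open>j = k - Suc i\<close> and take \<open>p ^ k\<close> out
  of each of the \<open>k\<close> factors; as \<open>q\<close> is the inverse of \<open>p\<close>,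
  the factor \<open>1 - q ^ Suc i\<close> remains.\<close>

lemma prod_power_diff_eq_qpoch:
  fixes p q :: "'a::comm_ring_1"
  assumes "p * q = 1"
  shows "(\<Prod>j<k. p ^ k - p ^ j) = p ^ k\<^sup>2 * qpoch q q k"
proof -
  have "p ^ k - p ^ (k - Suc i) = p ^ k * (1 - q * q ^ i)" if "i < k" for i
  proof -
    have "p ^ k * q ^ Suc i = p ^ (k - Suc i) * (p * q) ^ Suc i"
      using that by (simp only: power_mult_distrib mult.assoc [symmetric] power_add [symmetric]) simp
    then show ?thesis using assms by (simp add: algebra_simps)
  qed
  then have "(\<Prod>i<k. p ^ k - p ^ (k - Suc i)) = (\<Prod>i<k. p ^ k * (1 - q * q ^ i))"
    by (intro prod.cong) auto
  then show ?thesis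
    using prod.nat_diff_reindex [of "\<lambda>j. p ^ k - p ^ j" k]
    by (simp add: prod.distrib qpoch_def power_mult [symmetric] power2_eq_square)
qed

definition Q_scale :: "real \<Rightarrow> nat \<Rightarrow> real" where
  "Q_scale \<sigma> k =
    exp (- ((real k)\<^sup>2 * \<sigma>\<^sup>2 / 2)) / sqrt (qpoch (exp (- \<sigma>\<^sup>2)) (exp (- \<sigma>\<^sup>2)) k)"

lemma coeff_Q:
  "coeff (Q \<mu> \<sigma> k) i = (if i \<le> k then Q_scale \<sigma> k * ((- 1) ^ (k + i)
      * exp (- (real i * \<mu>) - (real i)\<^sup>2 * \<sigma>\<^sup>2 / 2)
      * esym (k - i) (map (\<lambda>j. exp (real j * \<sigma>\<^sup>2)) [0..<k])) else 0)"
  by (simp add: Q_def Q_scale_def coeff_sum if_distrib cong: if_cong)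

lemma qpoch_exp_pos: "\<sigma> \<noteq> 0 \<Longrightarrow> qpoch (exp (- \<sigma>\<^sup>2)) (exp (- \<sigma>\<^sup>2)) k > (0::real)"
  by (rule qpoch_pos) auto

lemma Q_scale_pos: "\<sigma> \<noteq> 0 \<Longrightarrow> Q_scale \<sigma> k > 0"
  by (simp add: Q_scale_def qpoch_exp_pos)

text \<open>The leading coefficient is nonzero: it is \<open>Q_scale \<sigma> k\<close> times an
  exponential, because \<open>esym 0\<close> is 1 and the sign is even.\<close>

lemma degree_Q:
  assumes "\<sigma> \<noteq> 0"
  shows "degree (Q \<mu> \<sigma> k) = k"
proof (rule antisym)
  show "degree (Q \<mu> \<sigma> k) \<le> k"
    by (rule degree_le) (simp add: coeff_Q)
  show "k \<le> degree (Q \<mu> \<sigma> k)"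
    using Q_scale_pos [OF assms, of k] by (intro le_degree) (simp add: coeff_Q)
qed

lemma has_bochner_integral_power_times_Q:
  assumes "\<sigma> > 0"
  shows "has_bochner_integral (lognormal \<mu> \<sigma>) (\<lambda>x. x ^ m * poly (Q \<mu> \<sigma> k) x)
    (Q_scale \<sigma> k * exp (real m * \<mu> + (real m)\<^sup>2 * \<sigma>\<^sup>2 / 2) * (\<Prod>j<k. exp (\<sigma>\<^sup>2) ^ m - exp (\<sigma>\<^sup>2) ^ j))"
proof -
  let ?xs = "map (\<lambda>j. exp (real j * \<sigma>\<^sup>2)) [0..<k]"
  let ?M = "\<lambda>n. exp (real n * \<mu> + (real n)\<^sup>2 * \<sigma>\<^sup>2 / 2)"
  let ?e = "\<lambda>i. (- 1) ^ (k + i) * esym (k - i) ?xs"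
  have "has_bochner_integral (lognormal \<mu> \<sigma>)
      (\<lambda>x. \<Sum>i\<le>k. coeff (Q \<mu> \<sigma> k) i * x ^ (m + i)) (\<Sum>i\<le>k. coeff (Q \<mu> \<sigma> k) i * ?M (m + i))"
    using assms by (intro has_bochner_integral_sum has_bochner_integral_mult_right
        has_bochner_integral_lognormal_power)
  moreover have "(\<Sum>i\<le>k. coeff (Q \<mu> \<sigma> k) i * x ^ (m + i)) = x ^ m * poly (Q \<mu> \<sigma> k) x" for x
    using assms by (simp add: poly_altdef degree_Q sum_distrib_left power_add mult_ac)
  moreover have "(\<Sum>i\<le>k. coeff (Q \<mu> \<sigma> k) i * ?M (m + i)) =
      Q_scale \<sigma> k * ?M m * (\<Prod>j<k. exp (\<sigma>\<^sup>2) ^ m - exp (\<sigma>\<^sup>2) ^ j)"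
  proof -
    \<comment> \<open>In the square of \<open>m + i\<close> the pure \<open>i\<close> terms cancel,
      and the cross term yields the \<open>i\<close>-th power of the point
      \<open>exp (\<sigma>\<^sup>2) ^ m\<close> at which Vieta's formula is then evaluated.\<close>
    have "exp (- (real i * \<mu>) - (real i)\<^sup>2 * \<sigma>\<^sup>2 / 2) * ?M (m + i) = ?M m * (exp (\<sigma>\<^sup>2) ^ m) ^ i" for i
    proof -
      have "exp (- (real i * \<mu>) - (real i)\<^sup>2 * \<sigma>\<^sup>2 / 2) * ?M (m + i) =
          exp (real m * \<mu> + (real m)\<^sup>2 * \<sigma>\<^sup>2 / 2 + real (m * i) * \<sigma>\<^sup>2)"
        by (simp add: exp_add [symmetric] power2_eq_square field_simps)
      also have "\<dots> = ?M m * (exp (\<sigma>\<^sup>2) ^ m) ^ i"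
        by (simp only: exp_add exp_of_nat_mult power_mult)
      finally show ?thesis .
    qed
    then have "coeff (Q \<mu> \<sigma> k) i * ?M (m + i) =
        Q_scale \<sigma> k * ?M m * (?e i * (exp (\<sigma>\<^sup>2) ^ m) ^ i)" if "i \<le> k" for i
      using that by (simp add: coeff_Q mult.assoc mult.left_commute)
    then have "(\<Sum>i\<le>k. coeff (Q \<mu> \<sigma> k) i * ?M (m + i)) =
        Q_scale \<sigma> k * ?M m * (\<Sum>i\<le>k. ?e i * (exp (\<sigma>\<^sup>2) ^ m) ^ i)"
      by (simp add: sum_distrib_left)
    also have "(\<Sum>i\<le>k. ?e i * (exp (\<sigma>\<^sup>2) ^ m) ^ i) = (\<Prod>x\<leftarrow>?xs. exp (\<sigma>\<^sup>2) ^ m - x)"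
      using prod_diff_eq_sum_esym [of "exp (\<sigma>\<^sup>2) ^ m" ?xs] by simp
    also have "\<dots> = (\<Prod>j<k. exp (\<sigma>\<^sup>2) ^ m - exp (\<sigma>\<^sup>2) ^ j)"
      by (simp add: prod.list_conv_set_nth atLeast0LessThan exp_of_nat_mult)
    finally show ?thesis .
  qed
  ultimately show ?thesis by simp
qed

text \<open>Expanding the factor of lower index into monomials involves only exponents
  \<open>m \<le> i \<le> k\<close>. Those below \<open>k\<close> contribute 0, so a term can survive
  only if \<open>i = k\<close>, namely the leading one.\<close>

lemma has_bochner_integral_Q_times_Q:
  assumes "\<sigma> > 0" "i \<le> k"
  shows "has_bochner_integral (lognormal \<mu> \<sigma>) (\<lambda>x. poly (Q \<mu> \<sigma> i) x * poly (Q \<mu> \<sigma> k) x)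
    (if i = k then 1 else 0)"
proof -
  let ?P = "\<lambda>m. \<Prod>j<k. exp (\<sigma>\<^sup>2) ^ m - exp (\<sigma>\<^sup>2) ^ j"
  let ?I = "\<lambda>m. Q_scale \<sigma> k * exp (real m * \<mu> + (real m)\<^sup>2 * \<sigma>\<^sup>2 / 2) * ?P m"
  let ?q = "exp (- \<sigma>\<^sup>2)"
  have "has_bochner_integral (lognormal \<mu> \<sigma>)
      (\<lambda>x. \<Sum>m\<le>i. coeff (Q \<mu> \<sigma> i) m * (x ^ m * poly (Q \<mu> \<sigma> k) x))
      (\<Sum>m\<le>i. coeff (Q \<mu> \<sigma> i) m * ?I m)"
    using assms by (intro has_bochner_integral_sum has_bochner_integral_mult_right
        has_bochner_integral_power_times_Q)
  moreover have "(\<Sum>m\<le>i. coeff (Q \<mu> \<sigma> i) m * (x ^ m * poly (Q \<mu> \<sigma> k) x)) =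
      poly (Q \<mu> \<sigma> i) x * poly (Q \<mu> \<sigma> k) x" for x
    using assms by (simp add: poly_altdef [of "Q \<mu> \<sigma> i"] degree_Q sum_distrib_right mult.assoc)
  moreover have "(\<Sum>m\<le>i. coeff (Q \<mu> \<sigma> i) m * ?I m) = (if i = k then 1 else 0)"
  proof -
    \<comment> \<open>The factor with \<open>j = m\<close> is zero.\<close>
    have vanish: "?P m = 0" if "m < k" for m
      using that by (intro prod_zero) auto
    show ?thesis
    proof (cases "i = k")
      case True
      have "(\<Sum>m\<le>k. coeff (Q \<mu> \<sigma> k) m * ?I m) = coeff (Q \<mu> \<sigma> k) k * ?I k"
        using sum.remove [of "{..k}" k "\<lambda>m. coeff (Q \<mu> \<sigma> k) m * ?I m"] vanish by simp
      \<comment> \<open>The exponential in the leading coefficient is the inverse of the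
        \<open>k\<close>-th moment, so only the two normalising constants remain beside
        \<open>?P k\<close>.\<close>
      also have "\<dots> = (Q_scale \<sigma> k)\<^sup>2 * ?P k"
        by (simp add: coeff_Q power2_eq_square mult_ac exp_add [symmetric])
      also have "?P k = exp ((real k)\<^sup>2 * \<sigma>\<^sup>2) * qpoch ?q ?q k"
        by (subst prod_power_diff_eq_qpoch [of _ ?q])
          (simp_all add: exp_of_nat_mult [symmetric] exp_add [symmetric])
      also have "(Q_scale \<sigma> k)\<^sup>2 = exp (- ((real k)\<^sup>2 * \<sigma>\<^sup>2)) / qpoch ?q ?q k"
        using assms qpoch_exp_pos [of \<sigma> k]
        by (simp add: Q_scale_def power_divide exp_double [symmetric])
      also have "\<dots> * (exp ((real k)\<^sup>2 * \<sigma>\<^sup>2) * qpoch ?q ?q k) = 1"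
        using assms qpoch_exp_pos [of \<sigma> k] by (simp add: exp_minus)
      finally show ?thesis using True by simp
    next
      case False
      then show ?thesis using assms vanish by (simp add: sum.neutral)
    qed
  qed
  ultimately show ?thesis by simp
qed

theorem theorem1p1:
  fixes \<mu> \<sigma> :: real
  assumes "\<sigma> > 0"
  shows "(\<forall>k. degree (Q \<mu> \<sigma> k) = k) \<and>
    (\<forall>i j. integrable (lognormal \<mu> \<sigma>) (\<lambda>x. poly (Q \<mu> \<sigma> i) x * poly (Q \<mu> \<sigma> j) x) \<and>
           (\<integral>x. poly (Q \<mu> \<sigma> i) x * poly (Q \<mu> \<sigma> j) x \<partial>lognormal \<mu> \<sigma>) = (if i = j then 1 else 0))"
proof -
  have "has_bochner_integral (lognormal \<mu> \<sigma>) (\<lambda>x. poly (Q \<mu> \<sigma> i) x * poly (Q \<mu> \<sigma> j) x)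
      (if i = j then 1 else 0)" for i j
  \<comment> \<open>The integrand is symmetric in \<open>i\<close> and \<open>j\<close>, so the
    ordered case suffices.\<close>
  proof (cases "i \<le> j")
    case True
    then show ?thesis using assms by (rule has_bochner_integral_Q_times_Q [rotated])
  next
    case False
    then show ?thesis
      using has_bochner_integral_Q_times_Q [OF assms, of j i \<mu>] by (simp add: mult.commute)
  qed
  then show ?thesis
    using assms by (simp add: degree_Q has_bochner_integral_iff)
qed

end
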